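(* A domain $D\subseteq\{0,1\}^n$ is a possibility domain if and only if there exists a possibility integrity constraint $\phi$ whose set of models equals $D$.
   Context: Standing assumption: domains $D\subseteq\{0,1\}^n$ are non-degenerate, i.e. the projection of $D$ onto each coordinate is $\{0,1\}$. A $k$-ary aggregator for $D$ ($k\ge 2$) is an $n$-tuple $(f_1,\ldots,f_n)$ of unanimous functions $f_j:\{0,1\}^k\to\{0,1\}$ such that whenever $x^1,\ldots,x^k\in D$, $(f_1(x^1_1,\ldots,x^k_1),\ldots,f_n(x^1_n,\ldots,x^k_n))\in D$. It is dictatorial if there is $d$ with $f_1=\cdots=f_n={\rm pr}^k_d$. $D$ is a possibility domain if it admits a non-dictatorial aggregator of some arity. A formula over $V=\{x_1,\ldots,x_n\}$ is: separable if $V$ can be partitioned into two non-empty disjoint sets with no clause containing variables from both; affine if it is a conjunction of exclusive-OR clauses of literals; partially Horn if there is a non-empty $V_0\subseteq V$ such that every clause containing only variables from $V_0$ is Horn (at most one positive literal) and variables of $V_0$ appear only negatively in clauses also containing variables outside $V_0$; renamable partially Horn if after swapping $x\leftrightarrow\neg x$ for all variables $x$ in some subset it becomes partially Horn. A possibility integrity constraint is a formula that is separable, renamable partially Horn, or affine. Its set of models is its set of satisfying assignments in $\{0,1\}^n$. *)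

theory Defs
  imports Main
begin

text \<open>
  The variables (issues) are the elements of a finite type \<open>'n\<close>, so that \<open>{0,1}^n\<close> is the
  type \<open>'n \<Rightarrow> bool\<close>. A \<open>k\<close>-tuple of bits is a list of length \<open>k\<close>; the values of
  a component \<open>f j :: bool list \<Rightarrow> bool\<close> on lists of other lengths are irrelevant.
\<close>

subsection \<open>Domains and aggregators\<close>

definition nondegenerate :: "('n \<Rightarrow> bool) set \<Rightarrow> bool" where
  "nondegenerate D \<longleftrightarrow> (\<forall>j. (\<lambda>x. x j) ` D = {False, True})"

definition unanimous :: "nat \<Rightarrow> (bool list \<Rightarrow> bool) \<Rightarrow> bool" where
  "unanimous k g \<longleftrightarrow> (\<forall>b. g (replicate k b) = b)"

definition aggregator :: "nat \<Rightarrow> ('n \<Rightarrow> bool) set \<Rightarrow> ('n \<Rightarrow> bool list \<Rightarrow> bool) \<Rightarrow> bool" where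
  "aggregator k D f \<longleftrightarrow>
     2 \<le> k \<and>
     (\<forall>j. unanimous k (f j)) \<and>
     (\<forall>xs. length xs = k \<and> set xs \<subseteq> D \<longrightarrow> (\<lambda>j. f j (map (\<lambda>x. x j) xs)) \<in> D)"

definition dictatorial :: "nat \<Rightarrow> ('n \<Rightarrow> bool list \<Rightarrow> bool) \<Rightarrow> bool" where
  "dictatorial k f \<longleftrightarrow> (\<exists>d<k. \<forall>j bs. length bs = k \<longrightarrow> f j bs = bs ! d)"

definition possibility_domain :: "('n \<Rightarrow> bool) set \<Rightarrow> bool" where
  "possibility_domain D \<longleftrightarrow> (\<exists>k f. aggregator k D f \<and> \<not> dictatorial k f)"

subsection \<open>Formulas\<close>

datatype 'v lit = is_Pos: Pos (var: 'v) | Neg (var: 'v)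

type_synonym 'v clause = "'v lit list"

text \<open>
  A formula is either in conjunctive normal form or a conjunction of exclusive-OR clauses.
  The Horn conditions below concern disjunctive clauses only.
\<close>

datatype 'v formula =
    is_CNF: CNF (clauses: "'v clause list")
  | is_XorCNF: XorCNF (clauses: "'v clause list")

definition clause_vars :: "'v clause \<Rightarrow> 'v set" where
  "clause_vars c = var ` set c"

text \<open>The literals of a clause are on pairwise different variables.\<close>

definition wf_formula :: "'v formula \<Rightarrow> bool" where
  "wf_formula \<phi> \<longleftrightarrow> (\<forall>c \<in> set (clauses \<phi>). distinct (map var c))"

fun lit_value :: "('v \<Rightarrow> bool) \<Rightarrow> 'v lit \<Rightarrow> bool" where
  "lit_value a (Pos x) \<longleftrightarrow> a x"
| "lit_value a (Neg x) \<longleftrightarrow> \<not> a x"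

fun satisfies :: "('v \<Rightarrow> bool) \<Rightarrow> 'v formula \<Rightarrow> bool" where
  "satisfies a (CNF cs) \<longleftrightarrow> (\<forall>c \<in> set cs. \<exists>l \<in> set c. lit_value a l)"
| "satisfies a (XorCNF cs) \<longleftrightarrow> (\<forall>c \<in> set cs. odd (length (filter (lit_value a) c)))"

definition models :: "'v formula \<Rightarrow> ('v \<Rightarrow> bool) set" where
  "models \<phi> = {a. satisfies a \<phi>}"

subsection \<open>Possibility integrity constraints\<close>

definition separable :: "'v formula \<Rightarrow> bool" where
  "separable \<phi> \<longleftrightarrow>
     (\<exists>V\<^sub>1 V\<^sub>2. V\<^sub>1 \<noteq> {} \<and> V\<^sub>2 \<noteq> {} \<and> V\<^sub>1 \<inter> V\<^sub>2 = {} \<and> V\<^sub>1 \<union> V\<^sub>2 = UNIV \<and>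
        (\<forall>c \<in> set (clauses \<phi>). \<not> (clause_vars c \<inter> V\<^sub>1 \<noteq> {} \<and> clause_vars c \<inter> V\<^sub>2 \<noteq> {})))"

definition horn_clause :: "'v clause \<Rightarrow> bool" where
  "horn_clause c \<longleftrightarrow> length (filter is_Pos c) \<le> 1"

definition partially_horn :: "'v formula \<Rightarrow> bool" where
  "partially_horn \<phi> \<longleftrightarrow>
     is_CNF \<phi> \<and>
     (\<exists>V\<^sub>0. V\<^sub>0 \<noteq> {} \<and>
        (\<forall>c \<in> set (clauses \<phi>).
           (clause_vars c \<subseteq> V\<^sub>0 \<longrightarrow> horn_clause c) \<and>
           (\<not> clause_vars c \<subseteq> V\<^sub>0 \<longrightarrow> (\<forall>x \<in> V\<^sub>0. Pos x \<notin> set c))))"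

fun rename_lit :: "'v set \<Rightarrow> 'v lit \<Rightarrow> 'v lit" where
  "rename_lit S (Pos x) = (if x \<in> S then Neg x else Pos x)"
| "rename_lit S (Neg x) = (if x \<in> S then Pos x else Neg x)"

fun rename_formula :: "'v set \<Rightarrow> 'v formula \<Rightarrow> 'v formula" where
  "rename_formula S (CNF cs) = CNF (map (map (rename_lit S)) cs)"
| "rename_formula S (XorCNF cs) = XorCNF (map (map (rename_lit S)) cs)"

definition renamable_partially_horn :: "'v formula \<Rightarrow> bool" where
  "renamable_partially_horn \<phi> \<longleftrightarrow> (\<exists>S. partially_horn (rename_formula S \<phi>))"

definition affine :: "'v formula \<Rightarrow> bool" where
  "affine \<phi> \<longleftrightarrow> is_XorCNF \<phi>"

definition possibility_integrity_constraint :: "'v formula \<Rightarrow> bool" where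
  "possibility_integrity_constraint \<phi> \<longleftrightarrow>
     wf_formula \<phi> \<and> (separable \<phi> \<or> renamable_partially_horn \<phi> \<or> affine \<phi>)"

end

theory Submission
  imports Defs
begin

text \<open>
  If every binary aggregator is dictatorial, then identifying arguments of an arbitrary aggregator
  in two groups shows that all its components are one and the same self-dual function, i.e. a
  family \<open>w\<close> of winning coalitions. Whenever some partition of the voters into three coalitions does
  not have exactly one winner, identifying arguments along it yields the majority or the minority
  operation; otherwise the last voter of the shortest winning initial segment wins
  alone and is a dictator.
  A nondictatorial binary aggregator \<open>f\<close>, in turn, either consists of projections or
  \<open>f (f x y) (f y x)\<close> is a conjunction or disjunction on a nonempty set of issues and the first
  projection elsewhere.

  Except in the minority case, the formula is the conjunction of all prime implicates of the domain:
  omitting one literal of a prime implicate gives a clause falsified in the domain, and combining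
  such witnesses by the closure operation would falsify the whole clause if it had a forbidden shape.
\<close>

section \<open>Closure operations from formulas\<close>

text \<open>A unanimous binary function is determined by its values at \<open>True False\<close> and
  \<open>False True\<close>. The last two premises rule out that all components are the second,
  respectively the first, projection.\<close>

lemma possibility_domain_binaryI:
  assumes "\<And>x y. x \<in> D \<Longrightarrow> y \<in> D \<Longrightarrow> (\<lambda>j. g j (x j) (y j)) \<in> D"
    and "\<And>j b. g j b b = b"
    and "\<exists>j. g j True False \<or> \<not> g j False True"
    and "\<exists>j. \<not> g j True False \<or> g j False True"
  shows "possibility_domain D"
proof -
  define f where "f = (\<lambda>j bs. g j (bs ! 0) (bs ! 1))"
  have "aggregator 2 D f"
    unfolding aggregator_def
  proof (intro conjI allI impI)
    fix xs assume xs: "length xs = 2 \<and> set xs \<subseteq> D"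
    then have "xs ! 0 \<in> D" "xs ! 1 \<in> D"
      by (auto simp: subset_iff)
    from assms(1)[OF this] show "(\<lambda>j. f j (map (\<lambda>x. x j) xs)) \<in> D"
      using xs by (simp add: f_def)
  qed (simp_all add: unanimous_def f_def assms(2))
  moreover have "\<not> dictatorial 2 f"
  proof
    assume "dictatorial 2 f"
    then obtain d where d: "d < 2" "\<And>j bs. length bs = 2 \<Longrightarrow> f j bs = bs ! d"
      unfolding dictatorial_def by blast
    have "g j True False = [True, False] ! d" "g j False True = [False, True] ! d" for j
      using d(2)[of "[True, False]" j] d(2)[of "[False, True]" j] by (simp_all add: f_def)
    moreover have "d = 0 \<or> d = 1" using d(1) by auto
    ultimately show False using assms(3,4) by auto
  qed
  ultimately show ?thesis unfolding possibility_domain_def by blast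
qed

section \<open>Separable formulas\<close>

lemma lit_value_cong: "a (var l) = b (var l) \<Longrightarrow> lit_value a l = lit_value b l"
  by (cases l) auto

lemma separable_imp_possibility_domain:
  assumes "separable \<phi>"
  shows "possibility_domain (models \<phi>)"
proof -
  obtain V W where VW: "V \<noteq> {}" "W \<noteq> {}" "V \<inter> W = {}" "V \<union> W = UNIV"
    and sep: "\<And>c. c \<in> set (clauses \<phi>) \<Longrightarrow> clause_vars c \<inter> V = {} \<or> clause_vars c \<inter> W = {}"
    using assms unfolding separable_def by metis
  show ?thesis
  proof (rule possibility_domain_binaryI[where g = "\<lambda>j a b. if j \<in> V then a else b"])
    fix x y assume xy: "x \<in> models \<phi>" "y \<in> models \<phi>"
    define z where "z = (\<lambda>j. if j \<in> V then x j else y j)"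
    \<comment> \<open>No clause meets both blocks, so each clause sees only \<open>x\<close> or only
      \<open>y\<close>. This serves both kinds of clauses at once.\<close>
    have agree: "(\<forall>l\<in>set c. lit_value z l = lit_value x l) \<or> (\<forall>l\<in>set c. lit_value z l = lit_value y l)"
      if "c \<in> set (clauses \<phi>)" for c
      using sep[OF that]
    proof
      assume "clause_vars c \<inter> V = {}"
      then have "lit_value z l = lit_value y l" if "l \<in> set c" for l
        using that by (intro lit_value_cong) (auto simp: z_def clause_vars_def)
      then show ?thesis by blast
    next
      assume "clause_vars c \<inter> W = {}"
      then have "var l \<in> V" if "l \<in> set c" for l
        using that VW(4) unfolding clause_vars_def by blast
      then have "lit_value z l = lit_value x l" if "l \<in> set c" for l
        using that by (intro lit_value_cong) (simp add: z_def)
      then show ?thesis by blast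
    qed
    have "z \<in> models \<phi>"
    proof (cases \<phi>)
      case (CNF cs)
      have "\<exists>l\<in>set c. lit_value z l" if c: "c \<in> set cs" for c
      proof -
        have "\<exists>l\<in>set c. lit_value x l" "\<exists>l\<in>set c. lit_value y l"
          using xy c unfolding CNF models_def by auto
        then show ?thesis using agree[of c] c unfolding CNF by auto
      qed
      then show ?thesis unfolding CNF models_def by simp
    next
      case (XorCNF cs)
      have "odd (length (filter (lit_value z) c))" if c: "c \<in> set cs" for c
      proof -
        have "filter (lit_value z) c = filter (lit_value x) c \<or> filter (lit_value z) c = filter (lit_value y) c"
          using agree[of c] c XorCNF by (auto intro: filter_cong)
        then show ?thesis using xy c XorCNF unfolding models_def by auto
      qed
      then show ?thesis using XorCNF unfolding models_def by simp
    qed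
    then show "(\<lambda>j. if j \<in> V then x j else y j) \<in> models \<phi>" by (simp add: z_def)
  qed (use VW in auto)
qed

section \<open>Renamable partially Horn formulas\<close>

lemma rename_lit_var [simp]: "var (rename_lit S l) = var l"
  by (cases l) auto

text \<open>Up to renaming the variables of \<open>S\<close>, this is conjunction on
  \<open>V\<close> and the first projection elsewhere: by De Morgan, the renaming exchanges
  conjunction and disjunction.\<close>

definition partial_and_or :: "'v set \<Rightarrow> 'v set \<Rightarrow> ('v \<Rightarrow> bool) \<Rightarrow> ('v \<Rightarrow> bool) \<Rightarrow> 'v \<Rightarrow> bool" where
  "partial_and_or V S x y j =
     (if j \<in> V then (if j \<in> S then x j \<or> y j else x j \<and> y j) else x j)"

lemma lit_value_partial_and_or:
  "lit_value (partial_and_or V S x y) l =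
     (if var l \<in> V
      then if is_Pos (rename_lit S l) then lit_value x l \<and> lit_value y l
           else lit_value x l \<or> lit_value y l
      else lit_value x l)"
  by (cases l) (auto simp: partial_and_or_def)

lemma horn_clause_iff:
  assumes "distinct c"
  shows "horn_clause c \<longleftrightarrow> (\<forall>p\<in>set c. \<forall>q\<in>set c. is_Pos p \<longrightarrow> is_Pos q \<longrightarrow> p = q)"
proof -
  have "length (filter is_Pos c) = card {l \<in> set c. is_Pos l}"
    using assms by (metis distinct_card distinct_filter set_filter)
  then show ?thesis
    unfolding horn_clause_def
    by (simp add: card_le_Suc0_iff_eq) blast
qed

lemma distinct_map_rename_lit:
  assumes "distinct (map var c)"
  shows "distinct (map (rename_lit S) c)"
proof -
  have "map var c = map var (map (rename_lit S) c)" by simp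
  then show ?thesis using assms by (metis distinct_map)
qed

text \<open>The two conditions on \<open>V\<close> merge into one: a literal over \<open>V\<close>
  that is positive after renaming confines its clause to \<open>V\<close> and is the only positive
  one there. Since the variables of a clause are distinct, counting positive literals in the list
  becomes a statement about the set.\<close>

lemma partially_horn_rename_CNF_iff:
  assumes "wf_formula (CNF cs)"
  shows "partially_horn (rename_formula S (CNF cs)) \<longleftrightarrow>
    (\<exists>V. V \<noteq> {} \<and> (\<forall>c\<in>set cs. \<forall>p\<in>set c. is_Pos (rename_lit S p) \<longrightarrow> var p \<in> V \<longrightarrow>
       var ` set c \<subseteq> V \<and> (\<forall>q\<in>set c. is_Pos (rename_lit S q) \<longrightarrow> p = q)))"
proof -
  let ?P = "\<lambda>V c. (clause_vars (map (rename_lit S) c) \<subseteq> V \<longrightarrow> horn_clause (map (rename_lit S) c)) \<and>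
        (\<not> clause_vars (map (rename_lit S) c) \<subseteq> V \<longrightarrow>
           (\<forall>x\<in>V. Pos x \<notin> set (map (rename_lit S) c)))"
  let ?Q = "\<lambda>V c. \<forall>p\<in>set c. is_Pos (rename_lit S p) \<longrightarrow> var p \<in> V \<longrightarrow>
       var ` set c \<subseteq> V \<and> (\<forall>q\<in>set c. is_Pos (rename_lit S q) \<longrightarrow> p = q)"
  have PQ: "?P V c \<longleftrightarrow> ?Q V c" if c: "c \<in> set cs" for c V
  proof -
    have dc: "distinct (map var c)"
      using assms c by (simp add: wf_formula_def)
    then have inj: "p = q" if "p \<in> set c" "q \<in> set c" "rename_lit S p = rename_lit S q" for p q
      using that by (metis distinct_map inj_onD rename_lit_var)
    have vars: "clause_vars (map (rename_lit S) c) = var ` set c"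
      by (simp add: clause_vars_def image_image)
    have horn: "horn_clause (map (rename_lit S) c) \<longleftrightarrow>
      (\<forall>p\<in>set c. \<forall>q\<in>set c. is_Pos (rename_lit S p) \<longrightarrow> is_Pos (rename_lit S q) \<longrightarrow> p = q)"
      unfolding horn_clause_iff[OF distinct_map_rename_lit[OF dc]] set_map ball_simps
      using inj by blast
    have Pos: "Pos x = rename_lit S p \<longleftrightarrow> is_Pos (rename_lit S p) \<and> x = var p" for x p
      by (cases p) auto
    have neg: "(\<forall>x\<in>V. Pos x \<notin> set (map (rename_lit S) c)) \<longleftrightarrow>
      (\<forall>p\<in>set c. is_Pos (rename_lit S p) \<longrightarrow> var p \<notin> V)"
      unfolding set_map image_iff Pos by blast
    show ?thesis unfolding vars horn neg by blast
  qed
  have "partially_horn (rename_formula S (CNF cs)) \<longleftrightarrow> (\<exists>V. V \<noteq> {} \<and> (\<forall>c\<in>set cs. ?P V c))"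
    by (simp add: partially_horn_def)
  also have "\<dots> \<longleftrightarrow> (\<exists>V. V \<noteq> {} \<and> (\<forall>c\<in>set cs. ?Q V c))"
    by (intro arg_cong[where f = Ex] ext conj_cong ball_cong refl PQ)
  finally show ?thesis .
qed

text \<open>Let \<open>x\<close> satisfy \<open>p\<close> and \<open>y\<close> satisfy
  \<open>q\<close> in the same clause. Off \<open>V\<close> the value of \<open>p\<close> is copied
  from \<open>x\<close>, and over \<open>V\<close> negative literals (after renaming) are disjoined,
  so \<open>p\<close> survives unless it is positive over \<open>V\<close>. In that case
  \<open>q\<close> also lies over \<open>V\<close> and is either \<open>p\<close> itself or
  negative, so \<open>q\<close> survives.\<close>

lemma renamable_partially_horn_imp_possibility_domain:
  assumes "wf_formula \<phi>" "renamable_partially_horn \<phi>"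
  shows "possibility_domain (models \<phi>)"
proof -
  obtain S where S: "partially_horn (rename_formula S \<phi>)"
    using assms(2) unfolding renamable_partially_horn_def by blast
  then obtain cs where \<phi>: "\<phi> = CNF cs"
    unfolding partially_horn_def by (cases \<phi>) auto
  have "wf_formula (CNF cs)" using assms(1) by (simp add: \<phi>)
  from S[unfolded \<phi> partially_horn_rename_CNF_iff[OF this]]
  obtain V where V: "V \<noteq> {}"
    and cl: "\<forall>c\<in>set cs. \<forall>p\<in>set c. is_Pos (rename_lit S p) \<longrightarrow> var p \<in> V \<longrightarrow>
       var ` set c \<subseteq> V \<and> (\<forall>q\<in>set c. is_Pos (rename_lit S q) \<longrightarrow> p = q)"
    by (elim exE conjE)
  have closed: "partial_and_or V S x y \<in> models \<phi>" if xy: "x \<in> models \<phi>" "y \<in> models \<phi>" for x y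
  proof -
    have "\<exists>l\<in>set c. lit_value (partial_and_or V S x y) l" if c: "c \<in> set cs" for c
    proof -
      obtain p q where p: "p \<in> set c" "lit_value x p" and q: "q \<in> set c" "lit_value y q"
        using xy c unfolding models_def \<phi> satisfies.simps mem_Collect_eq by blast
      show ?thesis
      proof (cases "is_Pos (rename_lit S p) \<and> var p \<in> V")
        case True
        then have "var q \<in> V" "is_Pos (rename_lit S q) \<longrightarrow> p = q"
          using cl[rule_format, OF c p(1)] q(1) by auto
        then have "lit_value (partial_and_or V S x y) q"
          using p q by (auto simp: lit_value_partial_and_or)
        then show ?thesis using q(1) by blast
      next
        case False
        then have "lit_value (partial_and_or V S x y) p"
          using p by (auto simp: lit_value_partial_and_or)
        then show ?thesis using p(1) by blast
      qed
    qed
    then show ?thesis by (simp add: models_def \<phi>)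
  qed
  show ?thesis
    by (rule possibility_domain_binaryI[where
          g = "\<lambda>j a b. if j \<in> V then (if j \<in> S then a \<or> b else a \<and> b) else a"])
      (use closed V in \<open>auto simp: partial_and_or_def[abs_def]\<close>)
qed

section \<open>Affine formulas\<close>

definition minority :: "('v \<Rightarrow> bool) \<Rightarrow> ('v \<Rightarrow> bool) \<Rightarrow> ('v \<Rightarrow> bool) \<Rightarrow> 'v \<Rightarrow> bool" where
  "minority x y z j \<longleftrightarrow> (x j \<noteq> (y j \<noteq> z j))"

definition odd_true :: "('v \<Rightarrow> bool) \<Rightarrow> 'v clause \<Rightarrow> bool" where
  "odd_true a c \<longleftrightarrow> odd (length (filter (lit_value a) c))"

lemma odd_true_simps [simp]:
  "odd_true a [] \<longleftrightarrow> False"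
  "odd_true a (l # c) \<longleftrightarrow> (lit_value a l \<noteq> odd_true a c)"
  by (auto simp: odd_true_def)

text \<open>Minority is the sum of three vectors over the two-element field. The constant
  contributed by a negated literal occurs three times, hence once, so the sum passes through
  literals and then through parities.\<close>

lemma lit_value_minority:
  "lit_value (minority x y z) l \<longleftrightarrow> (lit_value x l \<noteq> (lit_value y l \<noteq> lit_value z l))"
  by (cases l) (auto simp: minority_def)

lemma odd_true_minority:
  "odd_true (minority x y z) c \<longleftrightarrow> (odd_true x c \<noteq> (odd_true y c \<noteq> odd_true z c))"
  by (induction c) (auto simp: lit_value_minority)

lemma models_XorCNF: "models (XorCNF cs) = {a. \<forall>c\<in>set cs. odd_true a c}"
  by (simp add: models_def odd_true_def)

lemma affine_imp_possibility_domain: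
  assumes "affine \<phi>"
  shows "possibility_domain (models \<phi>)"
proof -
  obtain cs where \<phi>: "\<phi> = XorCNF cs"
    using assms unfolding affine_def by (cases \<phi>) auto
  have closed: "minority x y z \<in> models \<phi>" if "x \<in> models \<phi>" "y \<in> models \<phi>" "z \<in> models \<phi>" for x y z
    using that by (simp add: \<phi> models_XorCNF odd_true_minority)
  define f where "f = (\<lambda>(j::'a) bs. bs ! 0 \<noteq> (bs ! 1 \<noteq> bs ! 2))"
  have "aggregator 3 (models \<phi>) f"
    unfolding aggregator_def
  proof (intro conjI allI impI)
    fix xs assume xs: "length xs = 3 \<and> set xs \<subseteq> models \<phi>"
    then have "xs ! 0 \<in> models \<phi>" "xs ! 1 \<in> models \<phi>" "xs ! 2 \<in> models \<phi>"
      by (auto simp: subset_iff)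
    from closed[OF this] show "(\<lambda>j. f j (map (\<lambda>x. x j) xs)) \<in> models \<phi>"
      using xs by (simp add: f_def minority_def[abs_def])
  qed (simp_all add: unanimous_def f_def eval_nat_numeral)
  moreover have "\<not> dictatorial 3 f"
  proof
    assume "dictatorial 3 f"
    then obtain d where d: "d < 3" "\<And>j bs. length bs = 3 \<Longrightarrow> f j bs = bs ! d"
      unfolding dictatorial_def by blast
    have "[True, False, False] ! d" "[False, True, False] ! d"
      using d(2)[of "[True, False, False]"] d(2)[of "[False, True, False]"]
      by (simp_all add: f_def)
    moreover have "d = 0 \<or> d = 1 \<or> d = 2" using d(1) by auto
    ultimately show False by auto
  qed
  ultimately show ?thesis unfolding possibility_domain_def by blast
qed

section \<open>Formulas from closure operations\<close>

definition implicate :: "('v \<Rightarrow> bool) set \<Rightarrow> 'v lit set \<Rightarrow> bool" where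
  "implicate D L \<longleftrightarrow> (\<forall>a\<in>D. \<exists>l\<in>L. lit_value a l)"

text \<open>The clause \<open>x \<or> \<not> x\<close> may be a minimal implicate; it is excluded by the condition on \<open>var\<close>.\<close>

definition prime_implicate :: "('v \<Rightarrow> bool) set \<Rightarrow> 'v lit set \<Rightarrow> bool" where
  "prime_implicate D L \<longleftrightarrow> inj_on var L \<and> implicate D L \<and> (\<forall>l\<in>L. \<not> implicate D (L - {l}))"

text \<open>By minimality some member of \<open>D\<close> falsifies every literal except
  \<open>p\<close>; as it satisfies the whole clause, it makes \<open>p\<close> true. These
  witnesses are what the closure operations are applied to.\<close>

lemma prime_implicate_witness:
  assumes "prime_implicate D L" "p \<in> L"
  obtains x where "x \<in> D" "\<And>l. l \<in> L \<Longrightarrow> lit_value x l \<longleftrightarrow> l = p"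
proof -
  obtain x where "x \<in> D" "\<forall>l\<in>L - {p}. \<not> lit_value x l"
    using assms unfolding prime_implicate_def implicate_def by blast
  moreover obtain l where "l \<in> L" "lit_value x l"
    using assms(1) \<open>x \<in> D\<close> unfolding prime_implicate_def implicate_def by blast
  ultimately show thesis using that by blast
qed

lemma finite_UNIV_lit: "finite (UNIV :: 'n::finite lit set)"
proof -
  have "l \<in> range Pos \<union> range Neg" for l :: "'n lit" by (cases l) auto
  then have "(UNIV :: 'n lit set) \<subseteq> range Pos \<union> range Neg" by blast
  then show ?thesis by (rule finite_subset) simp
qed

lemma implicate_contains_prime_implicate:
  fixes L :: "'n::finite lit set"
  assumes "implicate D L" "inj_on var L"
  shows "\<exists>M\<subseteq>L. prime_implicate D M"
proof -
  have "finite L" by (rule finite_subset[OF subset_UNIV finite_UNIV_lit])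
  then show ?thesis using assms
  proof (induction L rule: finite_psubset_induct)
    case (psubset L)
    show ?case
    proof (cases "prime_implicate D L")
      case False
      then obtain l where l: "l \<in> L" "implicate D (L - {l})"
        using psubset.prems unfolding prime_implicate_def by blast
      moreover have "L - {l} \<subset> L" "inj_on var (L - {l})"
        using l(1) psubset.prems(2) by (auto intro: inj_on_subset)
      ultimately obtain M where "M \<subseteq> L - {l}" "prime_implicate D M"
        using psubset.IH[of "L - {l}"] by blast
      then show ?thesis by blast
    qed blast
  qed
qed

text \<open>Clauses are lists, but distinct variables bound their length. Hence a single formula can
  contain all clauses of a given kind.\<close>

lemma finite_wf_clauses: "finite {c :: 'n::finite clause. distinct (map var c)}"
proof (rule finite_subset)
  show "{c :: 'n clause. distinct (map var c)} \<subseteq> {c. set c \<subseteq> UNIV \<and> length c \<le> card (UNIV :: 'n set)}"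
  proof clarsimp
    fix c :: "'n clause" assume "distinct (map var c)"
    then have "length c = card (set (map var c))" by (metis distinct_card length_map)
    also have "\<dots> \<le> card (UNIV :: 'n set)" by (rule card_mono) auto
    finally show "length c \<le> card (UNIV :: 'n set)" .
  qed
qed (rule finite_lists_length_le[OF finite_UNIV_lit])

text \<open>For \<open>a\<close> outside \<open>D\<close>, the literals false at \<open>a\<close>
  form an implicate, since every member of \<open>D\<close> differs from \<open>a\<close> somewhere.
  A prime implicate inside it is a clause of the formula that \<open>a\<close> falsifies.\<close>

lemma prime_implicate_CNF:
  fixes D :: "('n::finite \<Rightarrow> bool) set"
  obtains cs where "wf_formula (CNF cs)" "models (CNF cs) = D"
    "\<And>c. c \<in> set cs \<Longrightarrow> prime_implicate D (set c)"
proof -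
  let ?C = "{c. distinct (map var c) \<and> prime_implicate D (set c)}"
  have "finite ?C" by (rule finite_subset[OF _ finite_wf_clauses]) auto
  from finite_list[OF this] obtain cs where cs: "set cs = ?C" by (elim exE)
  have "a \<in> D" if a: "a \<in> models (CNF cs)" for a
  proof (rule ccontr)
    assume "a \<notin> D"
    let ?L = "{l. \<not> lit_value a l}"
    have "implicate D ?L"
      unfolding implicate_def
    proof
      fix b assume "b \<in> D"
      then obtain j where "a j \<noteq> b j" using \<open>a \<notin> D\<close> by (metis ext[of a b])
      then show "\<exists>l\<in>?L. lit_value b l"
        by (intro bexI[of _ "if a j then Neg j else Pos j"]) auto
    qed
    moreover have "inj_on var ?L"
    proof (rule inj_onI)
      fix l m assume "l \<in> ?L" "m \<in> ?L" "var l = var m"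
      then show "l = m" by (cases l; cases m) auto
    qed
    ultimately obtain M where M: "M \<subseteq> ?L" "prime_implicate D M"
      using implicate_contains_prime_implicate by blast
    obtain c where c: "set c = M" "distinct c"
      using finite_distinct_list[OF finite_subset[OF subset_UNIV finite_UNIV_lit]] by blast
    with M have "c \<in> set cs" by (simp add: cs distinct_map prime_implicate_def)
    with a obtain l where "l \<in> M" "lit_value a l" using c unfolding models_def by auto
    with M show False by blast
  qed
  moreover have "D \<subseteq> models (CNF cs)"
    using cs unfolding models_def prime_implicate_def implicate_def by auto
  moreover have "wf_formula (CNF cs)" using cs by (simp add: wf_formula_def)
  ultimately show thesis using that[of cs] cs by blast
qed

section \<open>Formulas for the individual closure operations\<close>

lemma product_closed_imp_separable:
  fixes D :: "('n::finite \<Rightarrow> bool) set"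
  assumes V: "V \<noteq> {}" "V \<noteq> UNIV"
    and closed: "\<And>x y. x \<in> D \<Longrightarrow> y \<in> D \<Longrightarrow> (\<lambda>j. if j \<in> V then x j else y j) \<in> D"
  obtains \<phi> where "wf_formula \<phi>" "separable \<phi>" "models \<phi> = D"
proof -
  obtain cs where cs: "wf_formula (CNF cs)" "models (CNF cs) = D"
    "\<And>c. c \<in> set cs \<Longrightarrow> prime_implicate D (set c)"
    using prime_implicate_CNF[of D] by blast
  have "False" if c: "c \<in> set cs" and p: "p \<in> set c" "var p \<in> V" and q: "q \<in> set c" "var q \<notin> V" for c p q
  proof -
    obtain x where x: "x \<in> D" "\<And>l. l \<in> set c \<Longrightarrow> lit_value x l \<longleftrightarrow> l = p"
      using prime_implicate_witness[OF cs(3)[OF c] p(1)] by blast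
    obtain y where y: "y \<in> D" "\<And>l. l \<in> set c \<Longrightarrow> lit_value y l \<longleftrightarrow> l = q"
      using prime_implicate_witness[OF cs(3)[OF c] q(1)] by blast
    \<comment> \<open>The witnesses are crossed: on \<open>V\<close> the one for \<open>q\<close>,
      whose variable is outside \<open>V\<close>, and outside \<open>V\<close> the one for
      \<open>p\<close>. Both true literals are lost and the clause fails.\<close>
    define z where "z = (\<lambda>j. if j \<in> V then y j else x j)"
    have "z \<in> D" using closed[OF y(1) x(1)] by (simp add: z_def)
    then obtain l where l: "l \<in> set c" "lit_value z l"
      using cs(3)[OF c] unfolding prime_implicate_def implicate_def by blast
    have "lit_value z l = lit_value (if var l \<in> V then y else x) l"
      by (rule lit_value_cong) (simp add: z_def)
    with l x(2)[OF l(1)] y(2)[OF l(1)] p q show False by (auto split: if_splits)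
  qed
  then have "separable (CNF cs)"
    unfolding separable_def using V
    by (intro exI[of _ V] exI[of _ "- V"]) (auto simp: clause_vars_def)
  with cs show thesis using that by blast
qed

text \<open>Combine the witness \<open>x\<close> for \<open>p\<close> with the witness
  \<open>y\<close> for \<open>q\<close>. The positive literal \<open>p\<close> over \<open>V\<close>
  is conjoined and lost because \<open>y\<close> falsifies it. If \<open>q\<close> were off
  \<open>V\<close>, it would be copied from \<open>x\<close>; if positive over \<open>V\<close>,
  conjoined; either way the whole clause would be false.\<close>

lemma partial_and_or_closed_imp_renamable_partially_horn:
  fixes D :: "('n::finite \<Rightarrow> bool) set"
  assumes V: "V \<noteq> {}"
    and closed: "\<And>x y. x \<in> D \<Longrightarrow> y \<in> D \<Longrightarrow> partial_and_or V S x y \<in> D"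
  obtains \<phi> where "wf_formula \<phi>" "renamable_partially_horn \<phi>" "models \<phi> = D"
proof -
  obtain cs where cs: "wf_formula (CNF cs)" "models (CNF cs) = D"
    "\<And>c. c \<in> set cs \<Longrightarrow> prime_implicate D (set c)"
    using prime_implicate_CNF[of D] by blast
  have key: "var q \<in> V \<and> \<not> is_Pos (rename_lit S q)"
    if c: "c \<in> set cs" and p: "p \<in> set c" "is_Pos (rename_lit S p)" "var p \<in> V"
      and q: "q \<in> set c" "p \<noteq> q" for c p q
  proof (rule ccontr)
    assume nq: "\<not> ?thesis"
    obtain x where x: "x \<in> D" "\<And>l. l \<in> set c \<Longrightarrow> lit_value x l \<longleftrightarrow> l = p"
      using prime_implicate_witness[OF cs(3)[OF c] p(1)] by blast
    obtain y where y: "y \<in> D" "\<And>l. l \<in> set c \<Longrightarrow> lit_value y l \<longleftrightarrow> l = q"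
      using prime_implicate_witness[OF cs(3)[OF c] q(1)] by blast
    obtain l where l: "l \<in> set c" "lit_value (partial_and_or V S x y) l"
      using cs(3)[OF c] closed[OF x(1) y(1)]
      unfolding prime_implicate_def implicate_def by blast
    then show False
      using x(2)[OF l(1)] y(2)[OF l(1)] p q nq
      by (auto simp: lit_value_partial_and_or split: if_splits)
  qed
  have "partially_horn (rename_formula S (CNF cs))"
    unfolding partially_horn_rename_CNF_iff[OF cs(1)]
    using V key by (intro exI[of _ V]) blast
  with cs show thesis using that unfolding renamable_partially_horn_def by blast
qed

definition majority :: "('v \<Rightarrow> bool) \<Rightarrow> ('v \<Rightarrow> bool) \<Rightarrow> ('v \<Rightarrow> bool) \<Rightarrow> 'v \<Rightarrow> bool" where
  "majority x y z j \<longleftrightarrow> (if x j = y j then x j else z j)"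

lemma lit_value_majority:
  "lit_value (majority x y z) l \<longleftrightarrow>
     (if lit_value x l = lit_value y l then lit_value x l else lit_value z l)"
  by (cases l) (auto simp: majority_def)

text \<open>
  Prime implicates have at most two literals here, and renaming a model to the all-false assignment
  makes one of them negative.
\<close>

lemma majority_closed_imp_renamable_partially_horn:
  fixes D :: "('n::finite \<Rightarrow> bool) set"
  assumes "D \<noteq> {}"
    and closed: "\<And>x y z. x \<in> D \<Longrightarrow> y \<in> D \<Longrightarrow> z \<in> D \<Longrightarrow> majority x y z \<in> D"
  obtains \<phi> where "wf_formula \<phi>" "renamable_partially_horn \<phi>" "models \<phi> = D"
proof -
  obtain cs where cs: "wf_formula (CNF cs)" "models (CNF cs) = D"
    "\<And>c. c \<in> set cs \<Longrightarrow> prime_implicate D (set c)"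
    using prime_implicate_CNF[of D] by blast
  obtain a where a: "a \<in> D" using assms(1) by blast
  define S where "S = {j. a j}"
  have S: "is_Pos (rename_lit S l) \<longleftrightarrow> \<not> lit_value a l" for l
    by (cases l) (auto simp: S_def)
  have "p = q" if c: "c \<in> set cs" and p: "p \<in> set c" "\<not> lit_value a p"
      and q: "q \<in> set c" "\<not> lit_value a q" for c p q
  proof (rule ccontr)
    assume "p \<noteq> q"
    \<comment> \<open>As \<open>a\<close> satisfies \<open>r\<close> but neither \<open>p\<close>
      nor \<open>q\<close>, this is a third literal. Each literal of the clause is then true in at
      most one of the three witnesses, so their majority falsifies the clause.\<close>
    obtain r where r: "r \<in> set c" "lit_value a r"
      using a cs(3)[OF c] unfolding prime_implicate_def implicate_def by blast
    obtain x where x: "x \<in> D" "\<And>l. l \<in> set c \<Longrightarrow> lit_value x l \<longleftrightarrow> l = p"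
      using prime_implicate_witness[OF cs(3)[OF c] p(1)] by blast
    obtain y where y: "y \<in> D" "\<And>l. l \<in> set c \<Longrightarrow> lit_value y l \<longleftrightarrow> l = q"
      using prime_implicate_witness[OF cs(3)[OF c] q(1)] by blast
    obtain z where z: "z \<in> D" "\<And>l. l \<in> set c \<Longrightarrow> lit_value z l \<longleftrightarrow> l = r"
      using prime_implicate_witness[OF cs(3)[OF c] r(1)] by blast
    obtain l where l: "l \<in> set c" "lit_value (majority x y z) l"
      using cs(3)[OF c] closed[OF x(1) y(1) z(1)]
      unfolding prime_implicate_def implicate_def by blast
    then show False
      using x(2)[OF l(1)] y(2)[OF l(1)] z(2)[OF l(1)] \<open>p \<noteq> q\<close> p q r
      by (auto simp: lit_value_majority split: if_splits)
  qed
  then have "partially_horn (rename_formula S (CNF cs))"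
    unfolding partially_horn_rename_CNF_iff[OF cs(1)]
    by (intro exI[of _ UNIV]) (auto simp: S)
  with cs show thesis using that unfolding renamable_partially_horn_def by blast
qed

text \<open>In linear algebra: an affine subspace over the two-element field and a point whose
  projection to \<open>U\<close> it misses are separated by an affine functional in the coordinates
  \<open>U\<close>. The induction removes one coordinate \<open>u\<close> and splits
  \<open>E\<close> by the hyperplane \<open>e u = a u\<close>. Only the third case is hard: a
  functional \<open>c\<close> separating \<open>E0\<close> from \<open>a\<close> turns out to vanish
  on the rest of \<open>E\<close>, so adding the literal \<open>l\<close>, true exactly off the
  hyperplane, repairs it.\<close>

lemma minority_closed_separation:
  assumes "finite U"
    and "\<And>x y z. x \<in> E \<Longrightarrow> y \<in> E \<Longrightarrow> z \<in> E \<Longrightarrow> minority x y z \<in> E"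
    and "\<And>e. e \<in> E \<Longrightarrow> \<exists>j\<in>U. e j \<noteq> a j"
  shows "\<exists>c. distinct (map var c) \<and> var ` set c \<subseteq> U \<and> (\<forall>e\<in>E. odd_true e c) \<and> \<not> odd_true a c"
  using assms
proof (induction U arbitrary: E rule: finite_induct)
  case empty
  then show ?case by (intro exI[of _ "[]"]) auto
next
  case (insert u U)
  define l where "l = (if a u then Neg u else Pos u)"
  have l: "var l = u" "lit_value e l \<longleftrightarrow> e u \<noteq> a u" for e
    by (auto simp: l_def)
  define E0 where "E0 = {e \<in> E. e u = a u}"
  consider "\<forall>e\<in>E. \<exists>j\<in>U. e j \<noteq> a j" | "E0 = {}"
    | e' e0 where "e' \<in> E" "\<forall>j\<in>U. e' j = a j" "e0 \<in> E0"
    by blast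
  then show ?case
  proof cases
    case 1
    then have "\<exists>c. distinct (map var c) \<and> var ` set c \<subseteq> U \<and> (\<forall>e\<in>E. odd_true e c) \<and> \<not> odd_true a c"
      by (intro insert.IH insert.prems(1)) auto
    then show ?thesis by blast
  next
    case 2
    then show ?thesis
      by (intro exI[of _ "[l]"]) (auto simp: l E0_def)
  next
    case 3
    have "e' u \<noteq> a u" using 3 insert.prems(2)[of e'] by auto
    have "minority x y z \<in> E0" if "x \<in> E0" "y \<in> E0" "z \<in> E0" for x y z
    proof -
      have "minority x y z \<in> E" using that by (intro insert.prems(1)) (auto simp: E0_def)
      moreover have "minority x y z u = a u" using that by (auto simp: E0_def minority_def)
      ultimately show ?thesis by (simp add: E0_def)
    qed
    moreover have "\<exists>j\<in>U. e j \<noteq> a j" if "e \<in> E0" for e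
      using that insert.prems(2)[of e] by (auto simp: E0_def)
    ultimately obtain c where c: "distinct (map var c)" "var ` set c \<subseteq> U"
      "\<And>e. e \<in> E0 \<Longrightarrow> odd_true e c" "\<not> odd_true a c"
      using insert.IH[of E0] by metis
    have "filter (lit_value e') c = filter (lit_value a) c"
      using 3(2) c(2) by (intro filter_cong refl lit_value_cong) auto
    then have e': "\<not> odd_true e' c" using c(4) by (simp add: odd_true_def)
    have "\<not> odd_true e c" if e: "e \<in> E" "e u \<noteq> a u" for e
    proof -
      \<comment> \<open>The differences of \<open>e\<close> and \<open>e'\<close> from
        \<open>a\<close> at \<open>u\<close> cancel, so the sum lies in the hyperplane. There and at
        \<open>e0\<close> the parity is odd while it is even at \<open>e'\<close>, which forces it
        to be even at \<open>e\<close>.\<close>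
      have "minority e e' e0 \<in> E0"
      proof -
        have "e0 \<in> E" "e0 u = a u" using 3(3) by (auto simp: E0_def)
        then have "minority e e' e0 \<in> E" by (intro insert.prems(1) e(1) 3(1))
        moreover have "minority e e' e0 u = a u"
          using e(2) \<open>e' u \<noteq> a u\<close> \<open>e0 u = a u\<close> by (auto simp: minority_def)
        ultimately show ?thesis by (simp add: E0_def)
      qed
      then show ?thesis
        using c(3)[of "minority e e' e0"] c(3)[of e0] 3(3) e' by (simp add: odd_true_minority)
    qed
    then have "\<forall>e\<in>E. odd_true e (l # c)"
      using c(3) by (auto simp: l E0_def)
    then show ?thesis
      using c insert.hyps by (intro exI[of _ "l # c"]) (auto simp: l)
  qed
qed

lemma minority_closed_imp_affine:
  fixes D :: "('n::finite \<Rightarrow> bool) set"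
  assumes "\<And>x y z. x \<in> D \<Longrightarrow> y \<in> D \<Longrightarrow> z \<in> D \<Longrightarrow> minority x y z \<in> D"
  obtains \<phi> where "wf_formula \<phi>" "affine \<phi>" "models \<phi> = D"
proof -
  let ?C = "{c. distinct (map var c) \<and> (\<forall>a\<in>D. odd_true a c)}"
  have "finite ?C" by (rule finite_subset[OF _ finite_wf_clauses]) auto
  from finite_list[OF this] obtain cs where cs: "set cs = ?C" by (elim exE)
  have "a \<in> D" if a: "a \<in> models (XorCNF cs)" for a
  proof (rule ccontr)
    assume "a \<notin> D"
    then have "\<exists>j\<in>UNIV. e j \<noteq> a j" if "e \<in> D" for e
      using that ext[of e a] by blast
    then have "\<exists>c. distinct (map var c) \<and> var ` set c \<subseteq> UNIV \<and> (\<forall>e\<in>D. odd_true e c) \<and> \<not> odd_true a c"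
      by (intro minority_closed_separation finite assms)
    then obtain c where c: "distinct (map var c)" "\<forall>e\<in>D. odd_true e c" "\<not> odd_true a c"
      by (elim exE conjE)
    then have "c \<in> set cs" by (simp add: cs)
    with a c(3) show False unfolding models_XorCNF by blast
  qed
  moreover have "D \<subseteq> models (XorCNF cs)" by (auto simp: models_XorCNF cs)
  ultimately have "models (XorCNF cs) = D" by blast
  then show thesis using that[of "XorCNF cs"] cs by (simp add: wf_formula_def affine_def)
qed

section \<open>Closure operations from aggregators\<close>

lemma nondictatorial_binary_cases:
  assumes agg: "aggregator 2 D f" and nd: "\<not> dictatorial 2 f"
  obtains (product) V where "V \<noteq> {}" "V \<noteq> UNIV"
      "\<And>x y. x \<in> D \<Longrightarrow> y \<in> D \<Longrightarrow> (\<lambda>j. if j \<in> V then x j else y j) \<in> D"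
    | (and_or) V S where "V \<noteq> {}" "\<And>x y. x \<in> D \<Longrightarrow> y \<in> D \<Longrightarrow> partial_and_or V S x y \<in> D"
proof -
  define g where "g j a b = f j [a, b]" for j a b
  have g: "g j b b = b" for j b
    using agg by (simp add: g_def aggregator_def unanimous_def numeral_2_eq_2)
  have closed: "(\<lambda>j. g j (x j) (y j)) \<in> D" if "x \<in> D" "y \<in> D" for x y
  proof -
    have "\<forall>xs. length xs = 2 \<and> set xs \<subseteq> D \<longrightarrow> (\<lambda>j. f j (map (\<lambda>x. x j) xs)) \<in> D"
      using agg by (simp add: aggregator_def)
    from this[rule_format, of "[x, y]"] that show ?thesis by (simp add: g_def)
  qed
  \<comment> \<open>A unanimous binary function is conjunction, disjunction or a projection.
    \<open>V\<close> collects the issues of the first two types; \<open>S\<close> tells disjunction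
    from conjunction on \<open>V\<close> and first from second projection elsewhere.\<close>
  define V where "V = {j. g j True False = g j False True}"
  define S where "S = {j. g j True False}"
  show thesis
  proof (cases "V = {}")
    case True
    then have gS: "g j a b = (if j \<in> S then a else b)" for j a b
      using g[of j] by (cases a; cases b) (auto simp: V_def S_def)
    have two: "bs = [bs ! 0, bs ! 1]" if "length bs = 2" for bs :: "bool list"
      using that by (auto simp: numeral_2_eq_2 length_Suc_conv)
    have fS: "f j bs = (if j \<in> S then bs ! 0 else bs ! 1)" if "length bs = 2" for j bs
      using gS[of j "bs ! 0" "bs ! 1"] two[OF that] by (simp add: g_def)
    have "S \<noteq> {}"
      using nd fS unfolding dictatorial_def by (metis empty_iff one_less_numeral_iff semiring_norm(76))
    moreover have "S \<noteq> UNIV"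
      using nd fS unfolding dictatorial_def by (metis UNIV_I zero_less_numeral)
    ultimately show thesis using product closed by (simp add: gS)
  next
    case False
    have "partial_and_or V S x y \<in> D" if "x \<in> D" "y \<in> D" for x y
    proof -
      \<comment> \<open>On \<open>V\<close> both inner values agree, so unanimity returns
        \<open>g\<close> itself. A first projection stays one, and a second projection applied
        twice, with arguments swapped inside, becomes the first.\<close>
      have "(\<lambda>j. g j (g j (x j) (y j)) (g j (y j) (x j))) \<in> D"
        using closed[OF closed[OF that] closed[OF that(2,1)]] .
      moreover have "g j (g j a b) (g j b a) = (if j \<in> V then (if j \<in> S then a \<or> b else a \<and> b) else a)"
        for j a b
        by (cases a; cases b; cases "g j True False"; cases "g j False True")
          (auto simp: g V_def S_def)
      ultimately show ?thesis by (simp add: partial_and_or_def[abs_def])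
    qed
    with False show thesis using and_or by blast
  qed
qed

section \<open>Winning coalitions when all binary aggregators are dictatorial\<close>

lemma aggregator_minor:
  assumes agg: "aggregator k D f" and m: "2 \<le> m" "\<And>i. t i < m"
  shows "aggregator m D (\<lambda>j bs. f j (map (\<lambda>i. bs ! t i) [0..<k]))"
  unfolding aggregator_def
proof (intro conjI allI impI m(1))
  fix j
  have "map (\<lambda>i. replicate m b ! t i) [0..<k] = replicate k b" for b :: bool
    using m(2) by (intro nth_equalityI) auto
  then show "unanimous m (\<lambda>bs. f j (map (\<lambda>i. bs ! t i) [0..<k]))"
    using agg by (simp add: unanimous_def aggregator_def)
next
  fix xs assume xs: "length xs = m \<and> set xs \<subseteq> D"
  \<comment> \<open>Identification of arguments: voter \<open>i\<close> copies the vote at position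
    \<open>t i\<close>.\<close>
  let ?ys = "map (\<lambda>i. xs ! t i) [0..<k]"
  have "set ?ys \<subseteq> D" using xs m(2) by auto
  then have "(\<lambda>j. f j (map (\<lambda>x. x j) ?ys)) \<in> D"
    using agg unfolding aggregator_def by (simp del: map_map)
  moreover have "map (\<lambda>x. x j) ?ys = map (\<lambda>i. map (\<lambda>x. x j) xs ! t i) [0..<k]" for j
    using xs m(2) by simp
  ultimately show "(\<lambda>j. f j (map (\<lambda>i. map (\<lambda>x. x j) xs ! t i) [0..<k])) \<in> D"
    by (simp only:)
qed

text \<open>Let the voters of \<open>A\<close> vote one way and the others the opposite way. This
  binary minor has a dictator common to all issues, so one side wins on every issue: the winner is
  independent of the issue, and exactly one of \<open>A\<close> and \<open>- A\<close> wins.\<close>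

lemma coalition_family:
  assumes agg: "aggregator k D f"
    and binary: "\<forall>g. aggregator 2 D g \<longrightarrow> dictatorial 2 g"
  obtains w where "\<And>j A. f j (map (\<lambda>i. i \<in> A) [0..<k]) = w A" "\<And>A. w (- A) \<longleftrightarrow> \<not> w A"
proof -
  have same: "(\<forall>j. f j (map (\<lambda>i. i \<in> A) [0..<k]) \<and> \<not> f j (map (\<lambda>i. i \<in> - A) [0..<k])) \<or>
       (\<forall>j. \<not> f j (map (\<lambda>i. i \<in> A) [0..<k]) \<and> f j (map (\<lambda>i. i \<in> - A) [0..<k]))" for A
  proof -
    define t :: "nat \<Rightarrow> nat" where "t i = (if i \<in> A then 0 else 1)" for i
    have "dictatorial 2 (\<lambda>j bs. f j (map (\<lambda>i. bs ! t i) [0..<k]))"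
      by (intro binary[rule_format] aggregator_minor[OF agg]) (auto simp: t_def)
    then obtain d where d: "d < 2"
      "\<And>j bs. length bs = 2 \<Longrightarrow> f j (map (\<lambda>i. bs ! t i) [0..<k]) = bs ! d"
      unfolding dictatorial_def by blast
    have "[True, False] ! t i \<longleftrightarrow> i \<in> A" "[False, True] ! t i \<longleftrightarrow> i \<in> - A" for i
      by (auto simp: t_def)
    then have "f j (map (\<lambda>i. i \<in> A) [0..<k]) = [True, False] ! d"
      "f j (map (\<lambda>i. i \<in> - A) [0..<k]) = [False, True] ! d" for j
      using d(2)[of "[True, False]" j] d(2)[of "[False, True]" j] by simp_all
    moreover have "d = 0 \<or> d = 1" using d(1) by auto
    ultimately show ?thesis by auto
  qed
  show thesis
  proof (rule that)
    fix j A
    \<comment> \<open>All components agree, so any fixed issue can represent them.\<close>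
    show "f j (map (\<lambda>i. i \<in> A) [0..<k]) = f undefined (map (\<lambda>i. i \<in> A) [0..<k])"
      using same[of A] by blast
    show "f undefined (map (\<lambda>i. i \<in> - A) [0..<k]) \<longleftrightarrow> \<not> f undefined (map (\<lambda>i. i \<in> A) [0..<k])"
      using same[of A] by blast
  qed
qed

lemma no_nondictatorial_binary_cases:
  assumes agg: "aggregator k D f" and nd: "\<not> dictatorial k f"
    and binary: "\<forall>g. aggregator 2 D g \<longrightarrow> dictatorial 2 g"
  obtains (majority) "\<And>x y z. x \<in> D \<Longrightarrow> y \<in> D \<Longrightarrow> z \<in> D \<Longrightarrow> majority x y z \<in> D"
    | (minority) "\<And>x y z. x \<in> D \<Longrightarrow> y \<in> D \<Longrightarrow> z \<in> D \<Longrightarrow> minority x y z \<in> D"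
proof (rule ccontr)
  assume "\<not> thesis"
  then have nmaj: "\<not> (\<forall>x\<in>D. \<forall>y\<in>D. \<forall>z\<in>D. majority x y z \<in> D)"
    and nmin: "\<not> (\<forall>x\<in>D. \<forall>y\<in>D. \<forall>z\<in>D. minority x y z \<in> D)"
    using that by blast+
  obtain w where w: "\<And>j A. f j (map (\<lambda>i. i \<in> A) [0..<k]) = w A"
    and dual: "\<And>A. w (- A) \<longleftrightarrow> \<not> w A"
    using coalition_family[OF agg binary] by blast
  have "w UNIV"
  proof -
    have "map (\<lambda>i. i \<in> (UNIV :: nat set)) [0..<k] = replicate k True"
      by (intro nth_equalityI) auto
    then show ?thesis
      using w[of undefined UNIV] agg by (simp add: aggregator_def unanimous_def)
  qed
  then have "\<not> w {}" using dual[of UNIV] by simp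
  \<comment> \<open>The ternary minor along \<open>A\<close>, \<open>B\<close> and the rest. Since
    \<open>w\<close> is independent of the issue, the same function acts on every
    coordinate.\<close>
  define h where "h A B a b c = w {i. if i \<in> A then a else if i \<in> B then b else c}" for A B a b c
  have h_closed: "(\<lambda>j. h A B (x j) (y j) (z j)) \<in> D" if "x \<in> D" "y \<in> D" "z \<in> D" for A B x y z
  proof -
    let ?xs = "map (\<lambda>i. if i \<in> A then x else if i \<in> B then y else z) [0..<k]"
    have "(\<lambda>j. f j (map (\<lambda>x. x j) ?xs)) \<in> D"
    proof -
      have "length ?xs = k" "set ?xs \<subseteq> D" using that by auto
      then show ?thesis using agg unfolding aggregator_def by blast
    qed
    moreover have "f j (map (\<lambda>x. x j) ?xs) = h A B (x j) (y j) (z j)" for j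
      unfolding h_def w[of j, symmetric] by (auto intro!: arg_cong[where f = "f j"])
    ultimately show ?thesis by (simp only:)
  qed
  \<comment> \<open>By self-duality, the table of \<open>h\<close> depends only on which of the
    three coalitions win.\<close>
  have h_val: "h A B True False False \<longleftrightarrow> w A" "h A B False True False \<longleftrightarrow> w B"
      "h A B False False True \<longleftrightarrow> w C" "h A B False True True \<longleftrightarrow> \<not> w A"
      "h A B True False True \<longleftrightarrow> \<not> w B" "h A B True True False \<longleftrightarrow> \<not> w C"
      "h A B True True True" "\<not> h A B False False False"
    if "A \<inter> B = {}" "C = - (A \<union> B)" for A B C
  proof -
    have "{i. if i \<in> A then True else if i \<in> B then False else False} = A"
      "{i. if i \<in> A then False else if i \<in> B then True else False} = B"
      "{i. if i \<in> A then False else if i \<in> B then False else True} = C"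
      "{i. if i \<in> A then False else if i \<in> B then True else True} = - A"
      "{i. if i \<in> A then True else if i \<in> B then False else True} = - B"
      "{i. if i \<in> A then True else if i \<in> B then True else False} = - C"
      "{i. if i \<in> A then True else if i \<in> B then True else True} = UNIV"
      "{i. if i \<in> A then False else if i \<in> B then False else False} = {}"
      using that by (auto split: if_splits)
    then show "h A B True False False \<longleftrightarrow> w A" "h A B False True False \<longleftrightarrow> w B"
      "h A B False False True \<longleftrightarrow> w C" "h A B False True True \<longleftrightarrow> \<not> w A"
      "h A B True False True \<longleftrightarrow> \<not> w B" "h A B True True False \<longleftrightarrow> \<not> w C"
      "h A B True True True" "\<not> h A B False False False"
      unfolding h_def using dual \<open>w UNIV\<close> \<open>\<not> w {}\<close> by simp_all
  qed
  have ex1: "w A \<or> w B \<or> w (- (A \<union> B))" if AB: "A \<inter> B = {}" for A B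
  proof (rule ccontr)
    assume none: "\<not> ?thesis"
    have "h A B a b c = (if a = b then a else c)" for a b c
      using none h_val[OF AB refl] by (cases a; cases b; cases c) auto
    then show False using nmaj h_closed[of _ _ _ A B] by (simp add: majority_def[abs_def])
  qed
  have not2: "\<not> (w A \<and> w B)" if AB: "A \<inter> B = {}" for A B
  proof
    assume win: "w A \<and> w B"
    show False
    proof (cases "w (- (A \<union> B))")
      case True
      then have "h A B a b c \<longleftrightarrow> (a \<noteq> (b \<noteq> c))" for a b c
        using win h_val[OF AB refl] by (cases a; cases b; cases c) auto
      then show False using nmin h_closed[of _ _ _ A B] by (simp add: minority_def[abs_def])
    next
      case False
      \<comment> \<open>If \<open>a = b\<close>, then \<open>h A B a b\<close> is constantly
        \<open>a\<close>; otherwise it negates its last argument, and applying it twice restores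
        \<open>c\<close>.\<close>
      then have "h A B a b (h A B a b c) = (if a = b then a else c)" for a b c
        using win h_val[OF AB refl] by (cases a; cases b; cases c) auto
      then have "majority x y z \<in> D" if "x \<in> D" "y \<in> D" "z \<in> D" for x y z
        using h_closed[OF that(1,2) h_closed[OF that, of A B], of A B]
        unfolding majority_def[abs_def] by (simp only:)
      then show False using nmaj by blast
    qed
  qed
  \<comment> \<open>Coalitions and complements live in all of \<open>nat\<close>, but
    \<open>f\<close> reads only the voters below \<open>k\<close>.\<close>
  have restrict: "w (A \<inter> {..<k}) = w A" for A
    unfolding w[of undefined, symmetric] by (intro arg_cong[where f = "f undefined"] map_cong) auto
  define d where "d = (LEAST d. w {..d})"
  have "w {..k}"
  proof -
    have "{..k} \<inter> {..<k} = UNIV \<inter> {..<k}" by auto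
    then show ?thesis using restrict[of "{..k}"] restrict[of UNIV] \<open>w UNIV\<close> by simp
  qed
  then have d: "w {..d}" and least: "\<And>e. w {..e} \<Longrightarrow> d \<le> e"
    unfolding d_def by (auto intro: LeastI Least_le)
  have "\<not> w {..<d}"
  proof (cases d)
    case 0
    then show ?thesis using \<open>\<not> w {}\<close> by simp
  next
    case (Suc e)
    then show ?thesis using least[of e] by (auto simp: lessThan_Suc_atMost)
  qed
  \<comment> \<open>Among \<open>{d}\<close>, \<open>{..<d}\<close> and the rest, the second loses
    by minimality of \<open>d\<close> and the third by duality, so \<open>{d}\<close> wins.\<close>
  have "- ({d} \<union> {..<d}) = - {..d}" by auto
  then have wd: "w {d}"
    using ex1[of "{d}" "{..<d}"] \<open>\<not> w {..<d}\<close> dual[of "{..d}"] d by auto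
  have "d < k"
  proof (rule ccontr)
    assume "\<not> d < k"
    then have "{d} \<inter> {..<k} = {}" by auto
    then show False using restrict[of "{d}"] wd \<open>\<not> w {}\<close> by simp
  qed
  \<comment> \<open>Whichever of \<open>A\<close> and \<open>- A\<close> misses \<open>d\<close> is
    disjoint from the winner \<open>{d}\<close> and loses.\<close>
  have w_iff: "w A \<longleftrightarrow> d \<in> A" for A
    using not2[of "{d}" A] not2[of "{d}" "- A"] wd dual[of A] by auto
  have "f j bs = bs ! d" if "length bs = k" for j bs
  proof -
    have "bs = map (\<lambda>i. i \<in> {i. bs ! i}) [0..<k]"
      using that by (intro nth_equalityI) auto
    then have "f j bs = w {i. bs ! i}" using w[of j "{i. bs ! i}"] by simp
    then show ?thesis by (simp add: w_iff)
  qed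
  with \<open>d < k\<close> nd show False unfolding dictatorial_def by blast
qed

theorem theorem4p6:
  fixes D :: "('n::finite \<Rightarrow> bool) set"
  assumes "nondegenerate D"
  shows "possibility_domain D \<longleftrightarrow>
    (\<exists>\<phi>. possibility_integrity_constraint \<phi> \<and> models \<phi> = D)"
proof
  assume "possibility_domain D"
  then obtain k f where f: "aggregator k D f" "\<not> dictatorial k f"
    unfolding possibility_domain_def by blast
  \<comment> \<open>The majority case needs a model of \<open>D\<close> to rename by.\<close>
  have "D \<noteq> {}" using assms unfolding nondegenerate_def by auto
  have "\<exists>\<phi>. wf_formula \<phi> \<and> (separable \<phi> \<or> renamable_partially_horn \<phi> \<or> affine \<phi>) \<and> models \<phi> = D"
  proof (cases "\<exists>g. aggregator 2 D g \<and> \<not> dictatorial 2 g")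
    case True
    then obtain g where "aggregator 2 D g" "\<not> dictatorial 2 g" by blast
    then show ?thesis
    proof (cases rule: nondictatorial_binary_cases)
      case (product V)
      obtain \<phi> where "wf_formula \<phi>" "separable \<phi>" "models \<phi> = D"
      proof (rule product_closed_imp_separable)
        show "V \<noteq> {}" "V \<noteq> UNIV" by (rule product)+
        show "(\<lambda>j. if j \<in> V then x j else y j) \<in> D" if "x \<in> D" "y \<in> D" for x y
          using that by (rule product(3))
      qed
      then show ?thesis by blast
    next
      case (and_or V S)
      obtain \<phi> where "wf_formula \<phi>" "renamable_partially_horn \<phi>" "models \<phi> = D"
      proof (rule partial_and_or_closed_imp_renamable_partially_horn)
        show "V \<noteq> {}" by (rule and_or(1))
        show "partial_and_or V S x y \<in> D" if "x \<in> D" "y \<in> D" for x y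
          using that by (rule and_or(2))
      qed
      then show ?thesis by blast
    qed
  next
    case False
    then have "\<forall>g. aggregator 2 D g \<longrightarrow> dictatorial 2 g" by blast
    with f show ?thesis
    proof (cases rule: no_nondictatorial_binary_cases)
      case majority
      obtain \<phi> where "wf_formula \<phi>" "renamable_partially_horn \<phi>" "models \<phi> = D"
      proof (rule majority_closed_imp_renamable_partially_horn)
        show "D \<noteq> {}" by fact
        show "majority x y z \<in> D" if "x \<in> D" "y \<in> D" "z \<in> D" for x y z
          using that by (rule majority)
      qed
      then show ?thesis by blast
    next
      case minority
      obtain \<phi> where "wf_formula \<phi>" "affine \<phi>" "models \<phi> = D"
      proof (rule minority_closed_imp_affine)
        show "minority x y z \<in> D" if "x \<in> D" "y \<in> D" "z \<in> D" for x y z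
          using that by (rule minority)
      qed
      then show ?thesis by blast
    qed
  qed
  then show "\<exists>\<phi>. possibility_integrity_constraint \<phi> \<and> models \<phi> = D"
    unfolding possibility_integrity_constraint_def by blast
next
  assume "\<exists>\<phi>. possibility_integrity_constraint \<phi> \<and> models \<phi> = D"
  then show "possibility_domain D"
    unfolding possibility_integrity_constraint_def
    using separable_imp_possibility_domain renamable_partially_horn_imp_possibility_domain
      affine_imp_possibility_domain by blast
qed

end
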